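(* Let $G$ be a torsion group. Then: (1) $\mathcal{RP}^*(G)$ is triangle-free if and only if $\Omega(n)\le 2$ for every $n\in\pi_e(G)$; (2) $\mathcal{RP}(G)$ is triangle-free if and only if every non-trivial element of $G$ is of prime order.
   Context: For a group $G$ with identity $e$, the reduced power graph $\mathcal{RP}(G)$ is the simple graph with vertex set $G$ in which $u,v$ are adjacent if and only if $\langle v\rangle\subset\langle u\rangle$ or $\langle u\rangle\subset\langle v\rangle$, where $\subset$ means proper inclusion. The proper reduced power graph $\mathcal{RP}^*(G)$ is the subgraph of $\mathcal{RP}(G)$ induced on $G\setminus\{e\}$. $\pi_e(G)$ denotes the set of orders of elements of $G$. $\Omega(n)$ is the number of prime factors of $n$ counted with multiplicity. *)

theory Defs
  imports
    "HOL-Algebra.Multiplicative_Group"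
    "HOL-Algebra.Generated_Groups"
    "HOL-Computational_Algebra.Primes"
    "Graph_Theory.Digraph_Component"
begin

definition torsion_group :: "('a, 'b) monoid_scheme \<Rightarrow> bool" where
  "torsion_group G \<longleftrightarrow>
     group G \<and> (\<forall>x\<in>carrier G. \<exists>n::nat. n > 0 \<and> x [^]\<^bsub>G\<^esub> n = \<one>\<^bsub>G\<^esub>)"

text \<open>
  The library assigns order 0 to elements of infinite order; these contribute nothing
  to the set of element orders.
\<close>
definition element_orders :: "('a, 'b) monoid_scheme \<Rightarrow> nat set" where
  "element_orders G = {group.ord G x | x. x \<in> carrier G \<and> group.ord G x > 0}"

definition big_omega :: "nat \<Rightarrow> nat" where
  "big_omega n = size (prime_factorization n)"

text \<open>
  A simple graph is represented by a symmetric loop-free digraph without parallel arcs: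
  an edge between \<open>u\<close> and \<open>v\<close> is the pair of arcs \<open>(u, v)\<close> and \<open>(v, u)\<close>.
  The locales \<open>graph\<close> and \<open>pair_graph\<close> of the library are not used because they
  require finitely many vertices.
\<close>
definition reduced_power_graph :: "('a, 'b) monoid_scheme \<Rightarrow> ('a, 'a \<times> 'a) pre_digraph" where
  "reduced_power_graph G = with_proj
     \<lparr> pverts = carrier G,
       parcs = {(u, v). u \<in> carrier G \<and> v \<in> carrier G \<and>
                  (generate G {v} \<subset> generate G {u} \<or> generate G {u} \<subset> generate G {v})} \<rparr>"

definition proper_reduced_power_graph ::
    "('a, 'b) monoid_scheme \<Rightarrow> ('a, 'a \<times> 'a) pre_digraph" where
  "proper_reduced_power_graph G =
     induce_subgraph (reduced_power_graph G) (carrier G - {\<one>\<^bsub>G\<^esub>})"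

text \<open>
  Meant for symmetric digraphs only, where the orientation of the three arcs is immaterial.
\<close>
definition triangle_free :: "('a, 'b) pre_digraph \<Rightarrow> bool" where
  "triangle_free \<Gamma> \<longleftrightarrow>
     \<not> (\<exists>u\<in>verts \<Gamma>. \<exists>v\<in>verts \<Gamma>. \<exists>w\<in>verts \<Gamma>.
          u \<noteq> v \<and> v \<noteq> w \<and> u \<noteq> w \<and>
          (u, v) \<in> arcs_ends \<Gamma> \<and> (v, w) \<in> arcs_ends \<Gamma> \<and> (u, w) \<in> arcs_ends \<Gamma>)"

lemma reduced_power_graph_simple:
  "sym_digraph (reduced_power_graph G)"
  "loopfree_digraph (reduced_power_graph G)"
  "nomulti_digraph (reduced_power_graph G)"
  unfolding reduced_power_graph_def
  by (unfold_locales; auto simp: symmetric_def arc_to_ends_def intro!: symI)+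

lemma proper_reduced_power_graph_simple:
  "sym_digraph (proper_reduced_power_graph G)"
  "loopfree_digraph (proper_reduced_power_graph G)"
  "nomulti_digraph (proper_reduced_power_graph G)"
  unfolding proper_reduced_power_graph_def induce_subgraph_def reduced_power_graph_def
  by (unfold_locales; auto simp: symmetric_def arc_to_ends_def arcs_ends_def intro!: symI)+

end

theory Submission
  imports Defs
begin

text \<open>
  Three pairwise adjacent vertices of a reduced power graph generate cyclic subgroups that are
  pairwise comparable and distinct, so they can be ordered as a chain
  \<open>\<langle>a\<rangle> \<subset> \<langle>b\<rangle> \<subset> \<langle>c\<rangle>\<close>; conversely such a chain is a triangle (lemma
  \<open>triangle_free_iff_no_chain\<close>). In a torsion group, along a proper inclusion the order of the
  generator passes to a proper multiple, hence \<open>\<Omega>\<close> increases strictly (lemma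
  \<open>big_omega_ord_less\<close>). In the other direction, \<open>x\<^sup>d\<close> generates a proper subgroup of
  \<open>\<langle>x\<rangle>\<close>, of order \<open>ord x / d\<close>, for every divisor \<open>d > 1\<close> of \<open>ord x\<close> (lemma
  \<open>generate_pow_psubset\<close>).

  For the proper graph, a chain of non-trivial subgroups thus forces \<open>\<Omega> (ord c) \<ge> 3\<close>; and if
  \<open>ord x = p q m\<close> with \<open>p\<close> and \<open>q\<close> prime and \<open>m > 1\<close>, then \<open>x\<^bsup>pq\<^esup>\<close>, \<open>x\<^sup>p\<close>, \<open>x\<close> is a
  chain. For the full graph, the middle term of a chain is non-trivial, so \<open>ord c\<close> has a divisor
  strictly between \<open>1\<close> and itself; and if \<open>ord x\<close> is neither \<open>1\<close> nor prime, with prime divisor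
  \<open>p\<close>, then \<open>e\<close>, \<open>x\<^sup>p\<close>, \<open>x\<close> is a chain.
\<close>

section \<open>The number of prime factors\<close>

lemma big_omega_mult:
  assumes "m > 0" "n > 0"
  shows "big_omega (m * n) = big_omega m + big_omega n"
  using assms by (simp add: big_omega_def prime_factorization_mult)

lemma big_omega_eq_0_iff: "n > 0 \<Longrightarrow> big_omega n = 0 \<longleftrightarrow> n = 1"
  by (auto simp: big_omega_def prime_factorization_empty_iff)

lemma big_omega_prime: "Factorial_Ring.prime p \<Longrightarrow> big_omega p = 1"
  by (simp add: big_omega_def prime_factorization_prime)

lemma big_omega_proper_divisor_less:
  assumes "m dvd n" "m \<noteq> n" "n > 0"
  shows "big_omega m < big_omega n"
proof -
  obtain k where k: "n = m * k" using assms(1) by blast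
  then have "m > 0" "k > 0" "k \<noteq> 1" using assms by auto
  then show ?thesis
    using k big_omega_mult[of m k] big_omega_eq_0_iff[of k] by simp
qed

section \<open>Cyclic subgroups\<close>

context group
begin

lemma ord_proper_dvd_of_generate_psubset:
  assumes "a \<in> carrier G" "b \<in> carrier G" "generate G {a} \<subset> generate G {b}" "ord b > 0"
  shows "ord a dvd ord b" "ord a \<noteq> ord b"
proof -
  have "a \<in> generate G {b}"
    using assms(3) generate.incl[of a "{a}" G] by blast
  then obtain k :: int where "a = b [^] k"
    using generate_pow[OF assms(2)] by blast
  then have "a [^] int (ord b) = \<one>"
    using assms(2) by (simp add: int_pow_pow int_pow_eq_id)
  then show "ord a dvd ord b" using assms(1) int_pow_eq_id by simp
  \<comment> \<open>Finiteness of the subgroup is essential for the orders to differ: in the integers, all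
    non-trivial subgroups have generators of the same (infinite) order.\<close>
  have "finite (generate G {b})"
    using assms(2,4) generate_pow_card[of b] card_ge_0_finite by metis
  then have "card (generate G {a}) < card (generate G {b})"
    using assms(3) psubset_card_mono by blast
  then show "ord a \<noteq> ord b"
    using assms(1,2) by (simp add: generate_pow_card)
qed

lemma big_omega_ord_less:
  assumes "a \<in> carrier G" "b \<in> carrier G" "generate G {a} \<subset> generate G {b}" "ord b > 0"
  shows "big_omega (ord a) < big_omega (ord b)"
  using ord_proper_dvd_of_generate_psubset[OF assms] assms(4) by (rule big_omega_proper_divisor_less)

lemma generate_pow_psubset:
  assumes x: "x \<in> carrier G" and d: "d dvd ord x" "d > 1" and pos: "ord x > 0"
  shows "generate G {x [^] d} \<subset> generate G {x}" "ord (x [^] d) = ord x div d"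
proof -
  show o: "ord (x [^] d) = ord x div d"
    using x d by (intro ord_pow) auto
  have "x [^] d \<in> generate G {x}"
    using x by (auto simp: generate_pow intro!: exI[of _ "int d"] simp: int_pow_int)
  then have sub: "generate G {x [^] d} \<subseteq> generate G {x}"
    using x by (intro generate_subgroup_incl generate_is_subgroup) auto
  have "ord (x [^] d) < ord x" using o d pos by simp
  then have "generate G {x [^] d} \<noteq> generate G {x}"
    using x generate_pow_card by (metis nat_pow_closed nat_less_le)
  then show "generate G {x [^] d} \<subset> generate G {x}" using sub by blast
qed

end

section \<open>Triangles as chains of cyclic subgroups\<close>

text \<open>
  The graph enters only through its vertex set and its adjacency relation, so that the reduced
  power graph and the proper one are treated together.
\<close>
lemma triangle_free_iff_no_chain:
  assumes "verts \<Gamma> = S"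
    and "\<And>u v. (u, v) \<in> arcs_ends \<Gamma> \<longleftrightarrow> u \<in> S \<and> v \<in> S \<and>
      (generate G {v} \<subset> generate G {u} \<or> generate G {u} \<subset> generate G {v})"
  shows "triangle_free \<Gamma> \<longleftrightarrow>
    \<not> (\<exists>a\<in>S. \<exists>b\<in>S. \<exists>c\<in>S. generate G {a} \<subset> generate G {b} \<and> generate G {b} \<subset> generate G {c})"
    (is "_ \<longleftrightarrow> \<not> ?chain")
proof
  assume free: "triangle_free \<Gamma>"
  show "\<not> ?chain"
  proof
    assume ?chain
    then obtain a b c where abc: "a \<in> S" "b \<in> S" "c \<in> S"
      "generate G {a} \<subset> generate G {b}" "generate G {b} \<subset> generate G {c}" by blast
    have ac: "generate G {a} \<subset> generate G {c}" using abc by (meson psubset_trans)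
    have "a \<noteq> b" "b \<noteq> c" "a \<noteq> c" using abc ac by auto
    moreover have "(a, b) \<in> arcs_ends \<Gamma>" "(b, c) \<in> arcs_ends \<Gamma>" "(a, c) \<in> arcs_ends \<Gamma>"
      using abc ac by (simp_all add: assms(2))
    ultimately show False
      using free abc(1-3) unfolding triangle_free_def assms(1) by meson
  qed
next
  assume no_chain: "\<not> ?chain"
  show "triangle_free \<Gamma>"
  proof (rule ccontr)
    assume "\<not> triangle_free \<Gamma>"
    then obtain u v w where uvw: "u \<in> S" "v \<in> S" "w \<in> S"
      and arcs: "(u, v) \<in> arcs_ends \<Gamma>" "(v, w) \<in> arcs_ends \<Gamma>" "(u, w) \<in> arcs_ends \<Gamma>"
      unfolding triangle_free_def assms(1) by blast
    have "generate G {v} \<subset> generate G {u} \<or> generate G {u} \<subset> generate G {v}"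
      "generate G {w} \<subset> generate G {v} \<or> generate G {v} \<subset> generate G {w}"
      "generate G {w} \<subset> generate G {u} \<or> generate G {u} \<subset> generate G {w}"
      using arcs by (simp_all add: assms(2))
    then have ?chain using uvw by (meson psubset_trans)
    with no_chain show False by contradiction
  qed
qed

lemma reduced_power_graph_verts: "verts (reduced_power_graph G) = carrier G"
  by (simp add: reduced_power_graph_def)

lemma reduced_power_graph_arcs_ends:
  "(u, v) \<in> arcs_ends (reduced_power_graph G) \<longleftrightarrow> u \<in> carrier G \<and> v \<in> carrier G \<and>
    (generate G {v} \<subset> generate G {u} \<or> generate G {u} \<subset> generate G {v})"
  by (auto simp: reduced_power_graph_def arcs_ends_def arc_to_ends_def)

lemma proper_reduced_power_graph_verts:
  "verts (proper_reduced_power_graph G) = carrier G - {\<one>\<^bsub>G\<^esub>}"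
  by (simp add: proper_reduced_power_graph_def)

lemma proper_reduced_power_graph_arcs_ends:
  "(u, v) \<in> arcs_ends (proper_reduced_power_graph G) \<longleftrightarrow>
    u \<in> carrier G - {\<one>\<^bsub>G\<^esub>} \<and> v \<in> carrier G - {\<one>\<^bsub>G\<^esub>} \<and>
    (generate G {v} \<subset> generate G {u} \<or> generate G {u} \<subset> generate G {v})"
  by (auto simp: proper_reduced_power_graph_def reduced_power_graph_def induce_subgraph_def
      arcs_ends_def arc_to_ends_def)

section \<open>Triangle-freeness and element orders\<close>

lemma torsion_group_ord_pos:
  assumes "torsion_group G" "x \<in> carrier G"
  shows "group.ord G x > 0"
proof -
  interpret group G using assms(1) by (simp add: torsion_group_def)
  obtain n :: nat where "n > 0" "x [^]\<^bsub>G\<^esub> n = \<one>\<^bsub>G\<^esub>"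
    using assms by (auto simp: torsion_group_def)
  then show ?thesis using assms(2) pow_eq_id by (metis dvd_0_left_iff gr0I)
qed

lemma triangle_free_proper_reduced_power_graph_iff:
  fixes G (structure)
  assumes "torsion_group G"
  shows "triangle_free (proper_reduced_power_graph G) \<longleftrightarrow>
    (\<forall>n\<in>element_orders G. big_omega n \<le> 2)"
proof -
  interpret group G using assms by (simp add: torsion_group_def)
  note pos = torsion_group_ord_pos[OF assms]
  note chain = triangle_free_iff_no_chain[OF proper_reduced_power_graph_verts
      proper_reduced_power_graph_arcs_ends, of G]
  show ?thesis
  proof
    assume free: "triangle_free (proper_reduced_power_graph G)"
    show "\<forall>n\<in>element_orders G. big_omega n \<le> 2"
    proof (rule ccontr)
      assume "\<not> ?thesis"
      then obtain x where x: "x \<in> carrier G" and big: "big_omega (ord x) > 2"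
        by (auto simp: element_orders_def not_le)
      have "ord x \<noteq> 1" using big big_omega_eq_0_iff[of "ord x"] by auto
      then obtain p where p: "Factorial_Ring.prime p" "p dvd ord x" using prime_factor_nat by blast
      then obtain k where k: "ord x = p * k" by blast
      have k0: "k > 0" and p0: "p > 1" using pos[OF x] k p prime_gt_1_nat by auto
      have bigk: "big_omega k > 1"
        using big k k0 p0 p big_omega_mult[of p k] big_omega_prime[of p] by simp
      then have "k \<noteq> 1" using big_omega_eq_0_iff[of k] by auto
      then obtain q where q: "Factorial_Ring.prime q" "q dvd k" using prime_factor_nat by blast
      then obtain m where m: "k = q * m" by blast
      have m0: "m > 0" and q0: "q > 1" using k0 m q prime_gt_1_nat by auto
      have "big_omega m > 0"
        using bigk m m0 q0 q big_omega_mult[of q m] big_omega_prime[of q] by simp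
      then have m1: "m \<noteq> 1" using big_omega_eq_0_iff[of m] by auto
      define y where "y = x [^] p"
      define z where "z = y [^] q"
      have y: "y \<in> carrier G" "generate G {y} \<subset> generate G {x}" "ord y = k"
        using generate_pow_psubset[OF x p(2) p0 pos[OF x]] x k p0 by (auto simp: y_def)
      have z: "z \<in> carrier G" "generate G {z} \<subset> generate G {y}" "ord z = m"
        using generate_pow_psubset[of y q] y k0 q q0 m by (auto simp: z_def)
      have "x \<noteq> \<one>" "y \<noteq> \<one>" "z \<noteq> \<one>"
        using \<open>ord x \<noteq> 1\<close> \<open>k \<noteq> 1\<close> m1 y(3) z(3) ord_id by auto
      then have "x \<in> carrier G - {\<one>}" "y \<in> carrier G - {\<one>}" "z \<in> carrier G - {\<one>}"
        using x y(1) z(1) by auto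
      then show False using free[unfolded chain] y(2) z(2) by meson
    qed
  next
    assume small: "\<forall>n\<in>element_orders G. big_omega n \<le> 2"
    have False if a: "a \<in> carrier G - {\<one>}" and b: "b \<in> carrier G - {\<one>}"
      and c: "c \<in> carrier G - {\<one>}"
      and ab: "generate G {a} \<subset> generate G {b}" and bc: "generate G {b} \<subset> generate G {c}"
      for a b c
    proof -
      have "ord a \<noteq> 1" using a ord_eq_1 by auto
      then have "big_omega (ord a) \<ge> 1"
        using a pos big_omega_eq_0_iff[of "ord a"] by (cases "big_omega (ord a)") auto
      moreover have "big_omega (ord a) < big_omega (ord b)" "big_omega (ord b) < big_omega (ord c)"
        using a b c ab bc pos by (auto intro: big_omega_ord_less)
      moreover have "big_omega (ord c) \<le> 2"
        using small c pos by (auto simp: element_orders_def)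
      ultimately show False by linarith
    qed
    then show "triangle_free (proper_reduced_power_graph G)" unfolding chain by blast
  qed
qed

lemma triangle_free_reduced_power_graph_iff:
  fixes G (structure)
  assumes "torsion_group G"
  shows "triangle_free (reduced_power_graph G) \<longleftrightarrow>
    (\<forall>x\<in>carrier G - {\<one>\<^bsub>G\<^esub>}. Factorial_Ring.prime (group.ord G x))"
proof -
  interpret group G using assms by (simp add: torsion_group_def)
  note pos = torsion_group_ord_pos[OF assms]
  note chain = triangle_free_iff_no_chain[OF reduced_power_graph_verts
      reduced_power_graph_arcs_ends, of G]
  show ?thesis
  proof
    assume free: "triangle_free (reduced_power_graph G)"
    show "\<forall>x\<in>carrier G - {\<one>}. Factorial_Ring.prime (ord x)"
    proof (rule ccontr)
      assume "\<not> ?thesis"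
      then obtain x where x: "x \<in> carrier G" "x \<noteq> \<one>" "\<not> Factorial_Ring.prime (ord x)" by blast
      then have "ord x \<noteq> 1" using ord_eq_1 by auto
      then obtain p where p: "Factorial_Ring.prime p" "p dvd ord x" using prime_factor_nat by blast
      then obtain k where k: "ord x = p * k" by blast
      have k0: "k > 0" and p0: "p > 1" using pos[OF x(1)] k p prime_gt_1_nat by auto
      have k1: "k \<noteq> 1" using k p x(3) by auto
      define y where "y = x [^] p"
      have y: "y \<in> carrier G" "generate G {y} \<subset> generate G {x}" "ord y = k"
        using generate_pow_psubset[OF x(1) p(2) p0 pos[OF x(1)]] x k p0 by (auto simp: y_def)
      \<comment> \<open>The trivial subgroup arises as \<open>\<langle>y\<^sup>k\<rangle>\<close> with \<open>k = ord y > 1\<close>.\<close>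
      have "generate G {\<one>} \<subset> generate G {y}"
        using generate_pow_psubset(1)[of y k] y k0 k1 pow_ord_eq_1[of y] by simp
      then show False using free[unfolded chain] x(1) y(1,2) one_closed by meson
    qed
  next
    assume primes: "\<forall>x\<in>carrier G - {\<one>}. Factorial_Ring.prime (ord x)"
    have False if a: "a \<in> carrier G" and b: "b \<in> carrier G" and c: "c \<in> carrier G"
      and ab: "generate G {a} \<subset> generate G {b}" and bc: "generate G {b} \<subset> generate G {c}"
      for a b c
    proof -
      have ord_b: "ord b \<noteq> 1"
        using ord_proper_dvd_of_generate_psubset[OF a b ab pos[OF b]] by auto
      have bc': "ord b dvd ord c" "ord b \<noteq> ord c"
        using ord_proper_dvd_of_generate_psubset[OF b c bc pos[OF c]] by auto
      then have "c \<noteq> \<one>" using ord_b ord_id by auto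
      then have "Factorial_Ring.prime (ord c)" using primes c by blast
      then show False using bc' ord_b prime_nat_iff by blast
    qed
    then show "triangle_free (reduced_power_graph G)" unfolding chain by blast
  qed
qed

theorem corollary2p4:
  fixes G :: "('a, 'b) monoid_scheme"
  assumes "torsion_group G"
  shows "(triangle_free (proper_reduced_power_graph G) \<longleftrightarrow>
            (\<forall>n\<in>element_orders G. big_omega n \<le> 2)) \<and>
         (triangle_free (reduced_power_graph G) \<longleftrightarrow>
            (\<forall>x\<in>carrier G - {\<one>\<^bsub>G\<^esub>}. Factorial_Ring.prime (group.ord G x)))"
  using triangle_free_proper_reduced_power_graph_iff[OF assms]
    triangle_free_reduced_power_graph_iff[OF assms] by blast

end
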